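(* There is $N$ such that for every $n\ge N$ the following holds: for every root $x_0$ of the Jeff polynomial $J(x)$ other than its smallest root, the Mutt polynomial $M(x)$ has a root in the interval \[ \left[x_0-\frac{3}{10n^2},\ x_0+\frac{1}{2n^2}\right). \]
   Context: $T_m,U_m$ are Chebyshev polynomials: $T_m(\cos\theta)=\cos m\theta$, $U_m(\cos\theta)=\sin((m+1)\theta)/\sin\theta$. The Mutt polynomial is $M(x)=\dfrac{(2n-1)T_{2n+1}(\sqrt{x})+(2n+1)T_{2n-1}(\sqrt{x})}{x\sqrt{x}}$, a polynomial in $x$ of degree $n-1$. For an indeterminate $x$ let $(SU_{2n-1})(z)=\frac12\int_{-z}^{z}U'_{2n-1}(t)(x-t^2)\,dt=(x-z^2)U_{2n-1}(z)+\frac{T_{2n+1}(z)}{2n+1}+\frac{T_{2n-1}(z)}{2n-1}$, and let $\zeta_1,\dots,\zeta_{n-1}$ be the positive roots of $U'_{2n-1}$. The Jeff polynomial $J(x)\in\mathbb{Z}[x]$ is the (up to sign unique) integer polynomial with coprime coefficients that is a nonzero real scalar multiple of $\prod_{i=1}^{n-1}(SU_{2n-1})(\zeta_i)$; it has degree $n-1$ and real roots. *)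

theory Defs
  imports "HOL-Computational_Algebra.Computational_Algebra"
begin

fun cheb_T :: "nat \<Rightarrow> real poly" where
  "cheb_T 0 = 1"
| "cheb_T (Suc 0) = [:0, 1:]"
| "cheb_T (Suc (Suc m)) = smult 2 [:0, 1:] * cheb_T (Suc m) - cheb_T m"

fun cheb_U :: "nat \<Rightarrow> real poly" where
  "cheb_U 0 = 1"
| "cheb_U (Suc 0) = [:0, 2:]"
| "cheb_U (Suc (Suc m)) = smult 2 [:0, 1:] * cheb_U (Suc m) - cheb_U m"

text \<open>Numerator of the Mutt polynomial, as a polynomial in z = sqrt x:
  (2n-1) T_{2n+1}(z) + (2n+1) T_{2n-1}(z).  It is odd and divisible by z^3.\<close>

definition mutt_num :: "nat \<Rightarrow> real poly" where
  "mutt_num n = smult (2 * real n - 1) (cheb_T (2*n+1)) + smult (2 * real n + 1) (cheb_T (2*n-1))"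

text \<open>Mutt polynomial M(x) = mutt_num(sqrt x) / (x sqrt x), as a polynomial in x:
  its k-th coefficient is the (2k+3)-th coefficient of the odd polynomial mutt_num.\<close>

definition mutt :: "nat \<Rightarrow> real poly" where
  "mutt n = Abs_poly (\<lambda>k. coeff (mutt_num n) (2*k+3))"

definition zetas :: "nat \<Rightarrow> real set" where
  "zetas n = {z. 0 < z \<and> poly (pderiv (cheb_U (2*n-1))) z = 0}"

definition SU :: "nat \<Rightarrow> real \<Rightarrow> real poly" where
  "SU n z = [: poly (cheb_T (2*n+1)) z / (2 * real n + 1)
              + poly (cheb_T (2*n-1)) z / (2 * real n - 1)
              - z^2 * poly (cheb_U (2*n-1)) z,
             poly (cheb_U (2*n-1)) z :]"

definition jeff_real :: "nat \<Rightarrow> real poly" where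
  "jeff_real n = (\<Prod>z\<in>zetas n. SU n z)"

text \<open>Jeff polynomial: an integer polynomial with coprime coefficients that is a
  nonzero real scalar multiple of jeff_real n (unique up to sign).\<close>

definition jeff :: "nat \<Rightarrow> int poly" where
  "jeff n = (SOME J. content J = 1 \<and>
      (\<exists>c::real. c \<noteq> 0 \<and> map_poly real_of_int J = smult c (jeff_real n)))"

end

theory Submission
  imports Defs
begin

text \<open>
  Write \<open>\<zeta> = cos \<theta>\<close>. Then \<open>U'\<^bsub>2n-1\<^esub>(\<zeta>) = 0\<close> means \<open>tan (2n\<theta>) = 2n tan \<theta>\<close>, which has one solution
  \<open>\<theta>\<^sub>k\<close> in each interval \<open>(k\<pi>/2n, (k + 1/2)\<pi>/2n)\<close>, \<open>1 \<le> k \<le> n - 1\<close>. Inserting this relation into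
  \<open>SU\<close> shows that the roots of \<open>J\<close> are \<open>cos\<^sup>2 \<theta>\<^sub>k - 2/(4n\<^sup>2 - 1)\<close>. The substitution
  \<open>\<theta> \<mapsto> \<pi>/2 - \<theta>\<close> carries the equation of the Mutt roots to the same equation, so \<open>sin\<^sup>2 \<theta>\<^sub>k\<close> are
  roots of \<open>M\<close>. The root of \<open>J\<close> given by \<open>\<theta>\<^sub>k\<close>, \<open>k \<le> n - 2\<close>, is matched with the root
  \<open>cos\<^sup>2 \<phi> = sin\<^sup>2 \<theta>\<^bsub>n-1-k\<^esub>\<close> of \<open>M\<close>, where \<open>\<phi> = \<pi>/2 - \<theta>\<^bsub>n-1-k\<^esub>\<close> lies in the second half of
  \<open>(k\<pi>/2n, (k + 1)\<pi>/2n)\<close>. The theorem then becomes a two-sided estimate of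
  \<open>cos\<^sup>2 \<theta>\<^sub>k - cos\<^sup>2 \<phi> = sin (\<phi> - \<theta>\<^sub>k) sin (\<phi> + \<theta>\<^sub>k)\<close>.
\<close>

section \<open>Critical angles\<close>

text \<open>Division-free form of \<open>x \<le> tan x\<close>: the difference
  \<open>sin y - y * cos y\<close> vanishes at 0 and has derivative
  \<open>y * sin y\<close>.\<close>

lemma x_cos_le_sin:
  assumes "0 \<le> x" "x \<le> pi"
  shows "x * cos x \<le> sin (x::real)"
proof -
  have "(\<lambda>y. sin y - y * cos y) 0 \<le> (\<lambda>y. sin y - y * cos y) x"
  proof (rule DERIV_nonneg_imp_nondecreasing[OF assms(1)])
    fix y assume "0 \<le> y" "y \<le> x"
    then have "0 \<le> y * sin y" using assms by (intro mult_nonneg_nonneg sin_ge_zero) auto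
    moreover have "((\<lambda>y. sin y - y * cos y) has_real_derivative y * sin y) (at y)"
      by (auto intro!: derivative_eq_intros)
    ultimately show "\<exists>d. ((\<lambda>y. sin y - y * cos y) has_real_derivative d) (at y) \<and> 0 \<le> d"
      by blast
  qed
  then show ?thesis by simp
qed

text \<open>Encodes \<open>tan (2n\<theta>) = 2n tan \<theta>\<close>, the condition for \<open>cos \<theta>\<close> to be a critical point of
  \<open>U\<^bsub>2n-1\<^esub>\<close>, with \<open>k\<close> counting the branch of the tangent and \<open>\<alpha>\<close> the distance of \<open>2n\<theta>\<close>
  to the pole at the right end of the branch.\<close>
definition crit_angle :: "nat \<Rightarrow> nat \<Rightarrow> real \<Rightarrow> real \<Rightarrow> bool" where
  "crit_angle n k \<alpha> \<theta> \<longleftrightarrow> 0 < \<alpha> \<and> \<alpha> < pi/2 \<and> 2 * real n * \<theta> = real k * pi + pi/2 - \<alpha> \<and>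
     2 * real n * sin \<alpha> * sin \<theta> = cos \<alpha> * cos \<theta>"

text \<open>Intermediate value theorem in \<alpha>, with \<theta> read off from the linear relation.
  The bounds on \<open>k\<close> keep \<theta> strictly between 0 and \<open>pi/2\<close>, which
  fixes the signs at both ends.\<close>

lemma crit_angle_exists:
  assumes "1 \<le> k" "k < n"
  obtains \<alpha> \<theta> where "crit_angle n k \<alpha> \<theta>"
proof -
  define t where "t = (\<lambda>\<alpha>. (real k * pi + pi/2 - \<alpha>) / (2 * real n))"
  define f where "f = (\<lambda>\<alpha>. 2 * real n * sin \<alpha> * sin (t \<alpha>) - cos \<alpha> * cos (t \<alpha>))"
  have n: "real n > 0" "real k + 1 \<le> real n" using assms by auto
  have tr: "0 < t \<alpha> \<and> t \<alpha> < pi/2" if "0 \<le> \<alpha>" "\<alpha> \<le> pi/2" for \<alpha>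
  proof -
    have "0 < real k * pi" using assms by simp
    moreover have "(real k + 1) * pi \<le> real n * pi" using n by (intro mult_right_mono) auto
    ultimately have "0 < real k * pi + pi/2 - \<alpha>" "real k * pi + pi/2 - \<alpha> < pi * real n"
      using that pi_gt_zero unfolding distrib_right mult.commute[of "real n"] by linarith+
    then show ?thesis using n by (simp add: t_def field_simps)
  qed
  have f0: "f 0 < 0" using tr[of 0] cos_gt_zero[of "t 0"] by (simp add: f_def)
  have f1: "f (pi/2) > 0" using tr[of "pi/2"] sin_gt_zero[of "t (pi/2)"] n by (simp add: f_def)
  have "\<exists>\<alpha>\<ge>0. \<alpha> \<le> pi/2 \<and> f \<alpha> = 0"
  proof (rule IVT')
    show "continuous_on {0..pi/2} f" unfolding f_def t_def using n
      by (intro continuous_intros) auto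
  qed (use f0 f1 in auto)
  then obtain \<alpha> where a: "\<alpha> \<ge> 0" "\<alpha> \<le> pi/2" "f \<alpha> = 0" by blast
  with f0 f1 have "0 < \<alpha>" "\<alpha> < pi/2" by (metis less_irrefl order_le_less)+
  then have "crit_angle n k \<alpha> (t \<alpha>)" using a n by (simp add: crit_angle_def f_def t_def)
  then show thesis by (rule that)
qed

lemma crit_angle_bounds:
  assumes "crit_angle n k \<alpha> \<theta>" "k < n"
  shows "real k * pi / (2 * real n) < \<theta>" "\<theta> < real (Suc k) * pi / (2 * real n)" "0 < \<theta>" "\<theta> < pi/2"
proof -
  have n: "real n > 0" "real k + 1 \<le> real n" using assms by auto
  have "real k * pi < 2 * real n * \<theta>" and u: "2 * real n * \<theta> < real (Suc k) * pi"
    using assms by (auto simp: crit_angle_def algebra_simps)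
  then show a: "real k * pi / (2 * real n) < \<theta>" and "\<theta> < real (Suc k) * pi / (2 * real n)"
    using n by (auto simp: field_simps)
  from a show "0 < \<theta>" using n pi_gt_zero by (smt (verit) divide_nonneg_nonneg mult_nonneg_nonneg of_nat_0_le_iff)
  have "(real k + 1) * pi \<le> real n * pi" using n by (intro mult_right_mono) auto
  then have "2 * real n * \<theta> < real n * pi" using u by (simp add: algebra_simps)
  then show "\<theta> < pi/2" using n by (simp add: field_simps)
qed

lemma crit_angle_multiple:
  assumes "crit_angle n k \<alpha> \<theta>"
  shows "cos (2 * real n * \<theta>) = (-1)^k * sin \<alpha>" "sin (2 * real n * \<theta>) = (-1)^k * cos \<alpha>"
proof -
  have e: "2 * real n * \<theta> = (pi/2 - \<alpha>) + real k * pi" using assms by (simp add: crit_angle_def)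
  show "cos (2 * real n * \<theta>) = (-1)^k * sin \<alpha>"
    unfolding e cos_add by (simp add: cos_diff)
  show "sin (2 * real n * \<theta>) = (-1)^k * cos \<alpha>"
    unfolding e sin_add by (simp add: sin_diff)
qed

text \<open>Free of \<open>k\<close> and \<alpha>, this is the form in which the equation meets
  \<open>U'\<close>, \<open>SU\<close> and the Mutt polynomial.\<close>

lemma crit_angle_eq:
  assumes "crit_angle n k \<alpha> \<theta>"
  shows "2 * real n * cos (2 * real n * \<theta>) * sin \<theta> = sin (2 * real n * \<theta>) * cos \<theta>"
  using assms unfolding crit_angle_multiple[OF assms] by (simp add: crit_angle_def)

text \<open>With \<open>\<phi> = \<pi>/2 - \<psi>\<close> and \<open>D = \<phi> - \<theta>\<close> we have \<open>2nD = \<alpha> + \<beta>\<close>. The upper bound comes from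
  \<open>\<alpha> \<le> tan \<alpha> = cot \<theta> / 2n\<close> and \<open>\<beta> \<le> tan \<beta> = tan \<phi> / 2n\<close>. For the lower bound, one of
  \<open>cot \<theta>\<close>, \<open>tan \<phi>\<close> is at least 1, which forces \<open>D\<close> to have order \<open>1/n\<^sup>2\<close> and \<open>S\<close> order at least
  \<open>1/n\<^sup>3\<close>, whereas the bound has order \<open>1/n\<^sup>4\<close>.\<close>
lemma crit_angle_gap:
  assumes "crit_angle n k \<alpha> \<theta>" and "crit_angle n k' \<beta> \<psi>" and "k + k' + 1 = n"
    and k: "1 \<le> k" "1 \<le> k'" and n6: "6 \<le> n"
  defines "S \<equiv> (cos \<theta>)\<^sup>2 - (sin \<psi>)\<^sup>2"
  shows "S \<le> 2 / (4 * (real n)\<^sup>2 - 1) + 3 / (10 * (real n)\<^sup>2)"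
    and "2 / (4 * (real n)\<^sup>2 - 1) - 1 / (2 * (real n)\<^sup>2) < S"
proof -
  define a where "a = pi / (2 * real n)"
  define \<phi> where "\<phi> = pi/2 - \<psi>"
  define D where "D = \<phi> - \<theta>"
  have n: "real n \<ge> 6" using n6 by simp
  have n2: "6 * real n \<le> (real n)\<^sup>2" using n by (simp add: power2_eq_square)
  have bt: "0 < \<theta>" "\<theta> < pi/2" and bp: "0 < \<psi>" "\<psi> < pi/2"
    using crit_angle_bounds[OF assms(1)] crit_angle_bounds[OF assms(2)] assms(3) by auto
  have rk: "a \<le> real j * pi / (2 * real n)" if "1 \<le> j" for j
    unfolding a_def using that n pi_gt_zero by (intro divide_right_mono) auto
  have ta: "a \<le> \<theta>" "a \<le> \<psi>"
    using crit_angle_bounds(1)[OF assms(1)] crit_angle_bounds(1)[OF assms(2)] assms(3)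
      rk[OF k(1)] rk[OF k(2)] by auto
  have al: "0 < \<alpha>" "\<alpha> < pi/2" "2 * real n * sin \<alpha> * sin \<theta> = cos \<alpha> * cos \<theta>"
    and be: "0 < \<beta>" "\<beta> < pi/2" "2 * real n * sin \<beta> * sin \<psi> = cos \<beta> * cos \<psi>"
    using assms(1,2) by (auto simp: crit_angle_def)
  have "real n = real k + real k' + 1" using assms(3) by linarith
  then have "2 * real n * \<theta> + 2 * real n * \<psi> = real n * pi - (\<alpha> + \<beta>)"
    using assms(1,2) by (simp add: crit_angle_def algebra_simps)
  then have D2: "2 * real n * D = \<alpha> + \<beta>" by (simp add: D_def \<phi>_def algebra_simps)
  have D0: "0 < D" using D2 al be n
    by (smt (verit) mult_nonneg_nonpos)
  have "2 * real n * D \<le> pi" using D2 al be by linarith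
  then have Da: "D \<le> a" using n by (simp add: a_def field_simps)
  have "a \<le> pi / 12" unfolding a_def using n by (intro divide_left_mono) auto
  then have a12: "a \<le> pi/12" "0 < a" using n by (auto simp: a_def)
  have ss: "S = sin D * sin (\<phi> + \<theta>)"
  proof -
    have "S = (cos \<theta>)\<^sup>2 - (cos \<phi>)\<^sup>2" by (simp add: S_def \<phi>_def cos_diff)
    also have "\<dots> = (cos \<theta>)\<^sup>2 * ((sin \<phi>)\<^sup>2 + (cos \<phi>)\<^sup>2) - (cos \<phi>)\<^sup>2 * ((sin \<theta>)\<^sup>2 + (cos \<theta>)\<^sup>2)" by simp
    also have "\<dots> = sin D * sin (\<phi> + \<theta>)"
      unfolding D_def sin_diff sin_add by (simp only: algebra_simps power2_eq_square)
    finally show ?thesis .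
  qed
  \<comment> \<open>Since \<open>6 \<le> n\<close>, \<open>2 * a\<close> is at most
    \<open>pi/6\<close>. The value 5/6, just below \<open>sqrt 3 / 2\<close>, yields the constant of
    the theorem: 6/5 + 2 = 16/5, and a quarter of this is 1/2 + 3/10.\<close>
  have c6: "5/6 \<le> cos (2 * a)"
  proof -
    have "cos (pi/6) \<le> cos (2*a)" using a12 by (intro cos_monotone_0_pi_le) auto
    moreover have "5/3 \<le> sqrt 3" by (rule real_le_rsqrt) (simp add: power2_eq_square)
    then have "5/6 \<le> cos (pi/6)" by (simp add: cos_30)
    ultimately show ?thesis by linarith
  qed
  have st: "sin \<theta> > 0" "cos \<theta> > 0" "sin \<psi> > 0" "cos \<psi> > 0"
    using bt bp by (auto intro!: sin_gt_zero cos_gt_zero)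
  have sab: "sin \<alpha> > 0" "cos \<alpha> > 0" "sin \<beta> > 0" "cos \<beta> > 0"
    using al be by (auto intro!: sin_gt_zero cos_gt_zero)
  have cp: "cos \<phi> = sin \<psi>" "sin \<phi> = cos \<psi>" by (auto simp: \<phi>_def cos_diff sin_diff)
  \<comment> \<open>As \<theta> and \<psi> are at least \<open>a\<close>, the angle
    \<open>\<phi> + \<theta>\<close> lies between \<open>2*a+D\<close> and
    \<open>pi - (2*a+D)\<close>.\<close>
  have s_ge: "sin (2*a+D) \<le> sin (\<phi> + \<theta>)"
  proof -
    have "sin (\<phi>+\<theta>) - sin (2*a+D) = 2 * sin ((\<phi>+\<theta>-(2*a+D))/2) * cos ((\<phi>+\<theta>+(2*a+D))/2)"
      by (rule sin_diff_sin)
    moreover have "0 \<le> sin ((\<phi>+\<theta>-(2*a+D))/2)"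
      by (rule sin_ge_zero) (use ta bt bp a12 D0 in \<open>auto simp: D_def \<phi>_def field_simps\<close>)
    moreover have "0 \<le> cos ((\<phi>+\<theta>+(2*a+D))/2)"
      by (rule cos_ge_zero) (use ta bt bp a12 D0 in \<open>auto simp: D_def \<phi>_def field_simps\<close>)
    ultimately have "0 \<le> sin (\<phi>+\<theta>) - sin (2*a+D)" by (metis mult_nonneg_nonneg zero_le_numeral)
    then show ?thesis by simp
  qed
  define P where "P = sin \<theta> * cos \<phi>"
  have P0: "P > 0" using st by (simp add: P_def cp)
  have s2: "sin (\<phi> + \<theta>) = sin D + 2 * P"
    by (simp add: D_def P_def sin_add sin_diff algebra_simps)
  have PD: "sin D * (5/6) \<le> P"
  proof -
    have "sin (2*a+D) - sin D = 2 * (sin a * cos (a+D))"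
      using sin_diff_sin[of "2*a+D" D] by (simp add: algebra_simps add_divide_distrib)
    moreover have "sin D \<le> sin a" by (rule sin_monotone_2pi_le) (use Da D0 a12 in auto)
    moreover have "0 \<le> sin D" by (rule sin_ge_zero) (use Da D0 a12 in auto)
    moreover have "cos (2*a) \<le> cos (a+D)" by (rule cos_monotone_0_pi_le) (use Da D0 a12 in auto)
    ultimately have "sin D * (5/6) \<le> sin a * cos (a+D)" using c6 by (intro mult_mono) auto
    then show ?thesis using s2 s_ge \<open>sin (2*a+D) - sin D = _\<close> by linarith
  qed
  have ab: "2 * real n * \<alpha> * sin \<theta> \<le> cos \<theta>" "2 * real n * \<beta> * sin \<psi> \<le> cos \<psi>"
  proof -
    have "cos x * (2 * real n * x * sin y) \<le> cos x * cos y"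
      if "2 * real n * sin x * sin y = cos x * cos y" "0 < x" "x < pi/2" "sin y > 0" for x y :: real
    proof -
      have "(x * cos x) * (2 * real n * sin y) \<le> sin x * (2 * real n * sin y)"
        using that n by (intro mult_right_mono x_cos_le_sin) auto
      then show ?thesis using that(1) by (simp add: mult_ac)
    qed
    from this[OF al(3,1,2) st(1)] this[OF be(3,1,2) st(3)]
    show "2 * real n * \<alpha> * sin \<theta> \<le> cos \<theta>" "2 * real n * \<beta> * sin \<psi> \<le> cos \<psi>"
      using sab by simp_all
  qed
  \<comment> \<open>Weighted by \<open>cos \<phi>\<close> and \<open>sin \<theta>\<close>, the
    right-hand sides of the two bounds \<open>ab\<close> add up to
    \<open>cos (\<phi> - \<theta>)\<close>.\<close>
  have DP: "4 * (real n)\<^sup>2 * D * P \<le> 1"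
  proof -
    have "4 * (real n)\<^sup>2 * D * P = 2 * real n * (2 * real n * D) * P" by (simp add: power2_eq_square)
    also have "\<dots> = (2 * real n * \<alpha> * sin \<theta>) * cos \<phi> + (2 * real n * \<beta> * sin \<psi>) * sin \<theta>"
      unfolding D2 P_def cp by (simp add: algebra_simps)
    also have "\<dots> \<le> cos \<theta> * cos \<phi> + cos \<psi> * sin \<theta>"
      using ab st cp by (intro add_mono mult_right_mono) auto
    also have "\<dots> = cos D" unfolding D_def cos_diff by (simp add: cp)
    finally show ?thesis using cos_le_one[of D] by linarith
  qed
  have sD: "0 \<le> sin D" "sin D \<le> D"
    using D0 Da a12 by (auto intro!: sin_ge_zero sin_x_le_x)
  show "S \<le> 2 / (4 * (real n)\<^sup>2 - 1) + 3 / (10 * (real n)\<^sup>2)"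
  proof -
    have "S \<le> D * (16/5 * P)"
      unfolding ss s2 using sD PD P0 D0 by (intro mult_mono) auto
    then have "4 * (real n)\<^sup>2 * S \<le> 4 * (real n)\<^sup>2 * (D * (16/5 * P))"
      by (intro mult_left_mono) auto
    also have "\<dots> = 16/5 * (4 * (real n)\<^sup>2 * D * P)" by simp
    also have "\<dots> \<le> 16/5" using DP by linarith
    finally have "S \<le> (4/5) / (real n)\<^sup>2" using n by (simp add: field_simps)
    also have "\<dots> = 2 / (4 * (real n)\<^sup>2) + 3 / (10 * (real n)\<^sup>2)" using n by (simp add: field_simps)
    also have "2 / (4 * (real n)\<^sup>2) \<le> 2 / (4 * (real n)\<^sup>2 - 1)"
      using n2 n by (intro divide_left_mono mult_pos_pos) auto
    finally show ?thesis by simp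
  qed
  \<comment> \<open>For \<open>y \<le> pi/4\<close> the equation gives
    \<open>sin x \<ge> cos x / (2n)\<close>, which suffices while \<open>cos x \<ge> 1/2\<close>;
    beyond \<open>pi/3\<close>, \<open>x\<close> itself is large enough.\<close>
  have low: "1 / (4 * real n) \<le> x"
    if "2 * real n * sin x * sin y = cos x * cos y" "0 < x" "x < pi/2" "0 < y" "y \<le> pi/4" for x y :: real
  proof (cases "x \<le> pi/3")
    case True
    have "sin y \<le> sin (pi/4)" "cos (pi/4) \<le> cos y"
      using that by (auto intro!: sin_monotone_2pi_le cos_monotone_0_pi_le)
    then have yy: "sin y \<le> cos y" by (simp add: sin_45 cos_45)
    have "cos (pi/3) \<le> cos x" using True that by (intro cos_monotone_0_pi_le) auto
    then have cx: "1/2 \<le> cos x" by (simp add: cos_60)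
    have sy: "0 < sin y" using that by (intro sin_gt_zero) auto
    have "1/2 * sin y \<le> cos x * cos y" using cx yy sy by (intro mult_mono) auto
    also have "\<dots> = 2 * real n * sin x * sin y" using that by simp
    finally have "1/2 \<le> 2 * real n * sin x" using sy by simp
    moreover have "sin x \<le> x" using that by (intro sin_x_le_x) auto
    then have "2 * real n * sin x \<le> 2 * real n * x" by (intro mult_left_mono) auto
    ultimately have "1/2 \<le> 2 * real n * x" by linarith
    then show ?thesis using n by (simp add: field_simps)
  next
    case False
    then have "1/2 \<le> x" using pi_ge_two by linarith
    moreover have "1 / (4 * real n) \<le> 1/2" using n by (simp add: field_simps)
    ultimately show ?thesis by linarith
  qed
  have Dlow: "1 / (8 * (real n)\<^sup>2) \<le> D"
  proof -
    \<comment> \<open>\<open>D > 0\<close> says \<open>\<theta> + \<psi> < pi/2\<close>.\<close>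
    have "\<theta> \<le> pi/4 \<or> \<psi> \<le> pi/4" using D0 by (auto simp: D_def \<phi>_def)
    then have "1 / (4 * real n) \<le> \<alpha> + \<beta>" using low[OF al(3,1,2)] low[OF be(3,1,2)] al be bt bp by fastforce
    then show ?thesis unfolding D2[symmetric] using n by (simp add: field_simps power2_eq_square)
  qed
  have half: "x / 2 \<le> sin x" if "0 \<le> x" "x \<le> pi/6" for x :: real
  proof -
    have "cos (pi/3) \<le> cos x" using that by (intro cos_monotone_0_pi_le) auto
    then have "x * (1/2) \<le> x * cos x" using that by (intro mult_left_mono) (auto simp: cos_60)
    then show ?thesis using x_cos_le_sin[of x] that by simp
  qed
  show "2 / (4 * (real n)\<^sup>2 - 1) - 1 / (2 * (real n)\<^sup>2) < S"
  proof -
    have "1 / (2 * real n) \<le> a" unfolding a_def using pi_ge_two n by (intro divide_right_mono) auto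
    moreover have "2*a/2 \<le> sin (2*a)" using a12 by (intro half) auto
    moreover have "sin (2*a) \<le> sin (2*a+D)" by (rule sin_monotone_2pi_le) (use Da D0 a12 in auto)
    ultimately have A: "1 / (2 * real n) \<le> sin (\<phi> + \<theta>)" using s_ge by linarith
    have B: "1 / (16 * (real n)\<^sup>2) \<le> sin D" using half[of D] Dlow D0 Da a12 by (simp add: field_simps)
    have "1 / (32 * real n ^ 3) = 1 / (16 * (real n)\<^sup>2) * (1 / (2 * real n))"
      by (simp add: power2_eq_square power3_eq_cube)
    also have "\<dots> \<le> S" unfolding ss using A B sD by (intro mult_mono) auto
    finally have C: "1 / (32 * real n ^ 3) \<le> S" .
    have "2 / (4 * (real n)\<^sup>2 - 1) - 1 / (2 * (real n)\<^sup>2) = 1 / (2 * (real n)\<^sup>2 * (4 * (real n)\<^sup>2 - 1))"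
      using n n2 by (simp add: divide_simps)
    also have "\<dots> < 1 / (32 * real n ^ 3)"
    proof (rule divide_strict_left_mono)
      have "16 * real n < 4 * (real n)\<^sup>2 - 1" using n n2 by linarith
      then have "2 * (real n)\<^sup>2 * (16 * real n) < 2 * (real n)\<^sup>2 * (4 * (real n)\<^sup>2 - 1)"
        using n by (intro mult_strict_left_mono) auto
      then show "32 * real n ^ 3 < 2 * (real n)\<^sup>2 * (4 * (real n)\<^sup>2 - 1)"
        by (simp add: power2_eq_square power3_eq_cube)
    qed (use n n2 in auto)
    finally show ?thesis using C by linarith
  qed
qed

section \<open>Chebyshev and Mutt polynomials\<close>

lemma cheb_T_cos: "poly (cheb_T m) (cos t) = cos (real m * t)"
proof (induction m rule: cheb_T.induct)
  case (3 m)
  have "cos (real (Suc (Suc m)) * t) + cos (real m * t) = 2 * cos t * cos (real (Suc m) * t)"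
    using cos_plus_cos[of "real (Suc (Suc m)) * t" "real m * t"]
    by (simp add: algebra_simps add_divide_distrib)
  with 3 show ?case by simp
qed auto

lemma cheb_U_cos: "sin t * poly (cheb_U m) (cos t) = sin (real (Suc m) * t)"
proof (induction m rule: cheb_U.induct)
  case 2
  show ?case using sin_double[of t] by simp
next
  case (3 m)
  have "sin (real (Suc (Suc (Suc m))) * t) + sin (real (Suc m) * t)
      = 2 * cos t * sin (real (Suc (Suc m)) * t)"
    using sin_plus_sin[of "real (Suc (Suc (Suc m))) * t" "real (Suc m) * t"]
    by (simp add: algebra_simps add_divide_distrib)
  with 3 show ?case by (simp add: algebra_simps)
qed auto

text \<open>Differentiate \<open>cheb_U_cos\<close> in \<open>t\<close> and multiply by
  \<open>sin t\<close>. The cube of the sine avoids division, so the identity holds for every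
  \<open>t\<close>.\<close>

lemma cheb_U_pderiv_cos:
  "sin t ^ 3 * poly (pderiv (cheb_U m)) (cos t)
     = cos t * sin (real (Suc m) * t) - real (Suc m) * cos (real (Suc m) * t) * sin t"
proof -
  have "((\<lambda>t. sin t * poly (cheb_U m) (cos t)) has_real_derivative
      cos t * poly (cheb_U m) (cos t) - (sin t)\<^sup>2 * poly (pderiv (cheb_U m)) (cos t)) (at t)"
    by (auto intro!: derivative_eq_intros DERIV_chain'[where g = "poly (cheb_U m)"] poly_DERIV
        simp: power2_eq_square)
  moreover have "((\<lambda>t. sin (real (Suc m) * t)) has_real_derivative
      real (Suc m) * cos (real (Suc m) * t)) (at t)"
    by (auto intro!: derivative_eq_intros)
  ultimately have "cos t * poly (cheb_U m) (cos t) - (sin t)\<^sup>2 * poly (pderiv (cheb_U m)) (cos t)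
      = real (Suc m) * cos (real (Suc m) * t)"
    unfolding cheb_U_cos by (rule DERIV_unique)
  from arg_cong[OF this, of "(*) (sin t)"] show ?thesis
    unfolding cheb_U_cos[symmetric] by (simp add: algebra_simps power2_eq_square power3_eq_cube)
qed

lemma coeff_cheb_step:
  "coeff ([:0, 2:] * p) k = 2 * (if k = 0 then 0 else coeff p (k - 1) :: real)"
  by (cases k) auto

lemma coeff_cheb_T_parity: "odd (k + m) \<Longrightarrow> coeff (cheb_T m) k = 0"
  by (induction m arbitrary: k rule: cheb_T.induct)
    (auto simp: coeff_cheb_step coeff_pCons elim: oddE split: nat.splits simp del: mult_pCons_left)

lemma coeff_cheb_U_parity: "odd (k + m) \<Longrightarrow> coeff (cheb_U m) k = 0"
  by (induction m arbitrary: k rule: cheb_U.induct)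
    (auto simp: coeff_cheb_step coeff_pCons elim: oddE split: nat.splits simp del: mult_pCons_left)

lemma coeff_cheb_U_Ints: "coeff (cheb_U m) k \<in> \<int>"
  by (induction m arbitrary: k rule: cheb_U.induct)
    (auto simp: coeff_cheb_step coeff_pCons split: nat.splits simp del: mult_pCons_left)

lemma degree_cheb_U: "degree (cheb_U m) \<le> m"
proof (induction m rule: cheb_U.induct)
  case (3 m)
  have "coeff (cheb_U (Suc (Suc m))) k = 0" if "k > Suc (Suc m)" for k
    using that 3 by (auto simp: coeff_cheb_step coeff_eq_0 simp del: mult_pCons_left)
  then show ?case by (simp add: degree_le)
qed auto

text \<open>The recursion feeds each of the two coefficients into the other, hence the joint
  induction. The second makes the linear term of \<open>mutt_num\<close> cancel.\<close>

lemma coeff_cheb_T_0_1: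
  "coeff (cheb_T (2 * m)) 0 = (-1)^m \<and> coeff (cheb_T (Suc (2 * m))) (Suc 0) = (-1)^m * real (2 * m + 1)"
proof (induction m)
  case (Suc m)
  have e: "2 * Suc m = Suc (Suc (2 * m))" by simp
  show ?case using Suc unfolding e
    by (simp add: algebra_simps)
qed simp

section \<open>Polynomials of the form \<open>z ^ s * q (z\<^sup>2)\<close>\<close>

text \<open>The factor \<open>q\<close> above. The body has the shape of \<open>mutt\<close>, so
  that \<open>mutt n\<close> unfolds to the case \<open>s = 3\<close>.\<close>

definition every_second :: "nat \<Rightarrow> real poly \<Rightarrow> real poly" where
  "every_second s p = Abs_poly (\<lambda>k. coeff p (2 * k + s))"

lemma coeff_every_second: "coeff (every_second s p) k = coeff p (2 * k + s)"
proof -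
  have "\<forall>\<^sub>\<infinity>k. coeff p (2 * k + s) = 0"
    unfolding MOST_nat by (intro exI[of _ "degree p"]) (auto intro!: coeff_eq_0)
  then show ?thesis unfolding every_second_def by (subst poly.Abs_poly_inverse) auto
qed

lemma degree_every_second: "degree p \<le> 2 * d + s \<Longrightarrow> degree (every_second s p) \<le> d"
  by (intro degree_le) (auto simp: coeff_every_second intro!: coeff_eq_0)

lemma poly_every_second:
  assumes "\<And>i. (\<And>k. i \<noteq> 2 * k + s) \<Longrightarrow> coeff p i = 0"
  shows "poly p z = z ^ s * poly (every_second s p) (z\<^sup>2)"
proof -
  define d where "d = degree p"
  \<comment> \<open>The limit \<open>2*d+s\<close> may exceed the degree; it is the largest index
    hit by \<open>k \<le> d\<close>, so an index missed there is missed by every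
    \<open>k\<close>.\<close>
  have "poly p z = (\<Sum>i\<le>2*d+s. coeff p i * z ^ i)"
    unfolding poly_altdef by (rule sum.mono_neutral_left) (auto simp: d_def coeff_eq_0)
  also have "\<dots> = (\<Sum>i\<in>(\<lambda>k. 2*k+s) ` {..d}. coeff p i * z ^ i)"
  proof (rule sum.mono_neutral_right)
    show "\<forall>i\<in>{..2*d+s} - (\<lambda>k. 2*k+s) ` {..d}. coeff p i * z ^ i = 0"
    proof
      fix i assume i: "i \<in> {..2*d+s} - (\<lambda>k. 2*k+s) ` {..d}"
      then have "coeff p i = 0" by (intro assms) auto
      then show "coeff p i * z ^ i = 0" by simp
    qed
  qed auto
  also have "\<dots> = (\<Sum>k\<le>d. coeff p (2*k+s) * z ^ (2*k+s))"
    by (subst sum.reindex) (auto simp: inj_on_def)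
  also have "\<dots> = z ^ s * (\<Sum>k\<le>d. coeff (every_second s p) k * (z\<^sup>2) ^ k)"
    by (simp add: sum_distrib_left coeff_every_second power_add power_mult[symmetric] mult_ac)
  also have "(\<Sum>k\<le>d. coeff (every_second s p) k * (z\<^sup>2) ^ k) = poly (every_second s p) (z\<^sup>2)"
    unfolding poly_altdef using degree_every_second[of p d s]
    by (intro sum.mono_neutral_right) (auto simp: d_def coeff_eq_0)
  finally show ?thesis .
qed

text \<open>Even coefficients of \<open>mutt_num\<close> vanish by parity, and the two contributions
  to the linear one are opposite.\<close>

lemma poly_mutt:
  assumes "1 \<le> n"
  shows "z ^ 3 * poly (mutt n) (z\<^sup>2) = poly (mutt_num n) z"
proof -
  obtain m where n: "n = Suc m" using assms by (cases n) auto
  have "coeff (mutt_num n) i = 0" if i: "\<And>k. i \<noteq> 2 * k + 3" for i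
  proof (cases "even i")
    case True
    then show ?thesis unfolding mutt_num_def n by (simp add: coeff_cheb_T_parity del: cheb_T.simps)
  next
    case False
    then obtain j where j: "i = 2 * j + 1" by (rule oddE)
    with i[of "j - 1"] have "i = 1" by (cases j) auto
    have "coeff (cheb_T (2 * n + 1)) 1 = (-1)^n * (2 * real n + 1)"
      "coeff (cheb_T (2 * n - 1)) 1 = - ((-1)^n * (2 * real n - 1))"
      using coeff_cheb_T_0_1[of n] coeff_cheb_T_0_1[of m] by (simp_all add: n algebra_simps del: cheb_T.simps)
    then show ?thesis 
      unfolding mutt_num_def \<open>i = 1\<close> coeff_add coeff_smult by (simp only:) (simp add: algebra_simps)
  qed
  then have "poly (mutt_num n) z = z ^ 3 * poly (every_second 3 (mutt_num n)) (z\<^sup>2)"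
    by (rule poly_every_second)
  then show ?thesis by (simp add: mutt_def every_second_def)
qed

text \<open>At \<open>\<pi>/2 - t\<close> the equation of the Mutt roots becomes the equation of the critical angles.\<close>
lemma mutt_root:
  assumes "1 \<le> n" "sin t \<noteq> 0"
    and "2 * real n * cos (2 * real n * t) * sin t = sin (2 * real n * t) * cos t"
  shows "poly (mutt n) ((sin t)\<^sup>2) = 0"
proof -
  define s where "s = pi/2 - t"
  define w where "w = 2 * real n * s"
  have w: "w = real n * pi - 2 * real n * t" by (simp add: w_def s_def algebra_simps)
  have cw: "cos w = (-1)^n * cos (2 * real n * t)" "sin w = - ((-1)^n * sin (2 * real n * t))"
    unfolding w by (simp_all add: cos_diff sin_diff)
  have cs: "cos s = sin t" "sin s = cos t" by (auto simp: s_def cos_diff sin_diff)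
  have e: "real (2*n+1) * s = w + s" "real (2*n-1) * s = w - s"
    using assms(1) by (auto simp: w_def algebra_simps of_nat_diff)
  have "poly (mutt_num n) (cos s) = 4 * real n * (cos w * cos s) + 2 * (sin w * sin s)"
    unfolding mutt_num_def poly_add poly_smult cheb_T_cos e cos_add cos_diff by (simp add: algebra_simps)
  also have "\<dots> = 2 * (-1)^n * (2 * real n * cos (2 * real n * t) * sin t - sin (2 * real n * t) * cos t)"
    unfolding cw cs by (simp add: algebra_simps)
  also have "\<dots> = 0" using assms(3) by simp
  finally show ?thesis using poly_mutt[OF assms(1), of "cos s"] assms(2) by (simp add: cs)
qed

text \<open>At a critical angle the equation and \<open>sin\<^sup>2 + cos\<^sup>2 = 1\<close> turn
  the two \<open>T\<close> terms of \<open>SU\<close> into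
  \<open>2 * u / (4 * n\<^sup>2 - 1)\<close>, so \<open>u\<close> factors out.\<close>

lemma SU_crit:
  assumes "1 \<le> n" "sin t \<noteq> 0" "sin (2 * real n * t) \<noteq> 0"
    and eq: "2 * real n * cos (2 * real n * t) * sin t = sin (2 * real n * t) * cos t"
  defines "u \<equiv> poly (cheb_U (2 * n - 1)) (cos t)"
  shows "u \<noteq> 0" and "SU n (cos t) = smult u [: 2 / (4 * (real n)\<^sup>2 - 1) - (cos t)\<^sup>2, 1:]"
proof -
  define w where "w = 2 * real n * t"
  have "sin t * u = sin (real (Suc (2*n-1)) * t)" unfolding u_def by (rule cheb_U_cos)
  also have "real (Suc (2*n-1)) = 2 * real n" using assms(1) by simp
  finally have u: "sin t * u = sin w" by (simp add: w_def)
  then show "u \<noteq> 0" using assms(3) by (auto simp: w_def)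
  have e: "real (2*n+1) * t = w + t" "real (2*n-1) * t = w - t"
    using assms(1) by (auto simp: w_def algebra_simps of_nat_diff)
  have n: "real n \<ge> 1" using assms(1) by simp
  have "1 \<le> (real n)\<^sup>2" using n by simp
  then have nz: "2 * real n + 1 \<noteq> 0" "2 * real n - 1 \<noteq> 0" "4 * (real n)\<^sup>2 - 1 \<noteq> 0" using n by linarith+
  have fac: "4 * (real n)\<^sup>2 - 1 = (2 * real n + 1) * (2 * real n - 1)" by (simp add: algebra_simps power2_eq_square)
  have "cos (w + t) / (2 * real n + 1) + cos (w - t) / (2 * real n - 1)
      = (4 * real n * cos w * cos t + 2 * sin w * sin t) / (4 * (real n)\<^sup>2 - 1)"
    unfolding fac cos_add cos_diff using nz by (simp add: divide_simps) (simp add: algebra_simps)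
  also have "4 * real n * cos w * cos t + 2 * sin w * sin t = 2 * u"
  proof -
    have "sin t * (4 * real n * cos w * cos t + 2 * sin w * sin t)
        = 2 * cos t * (2 * real n * cos w * sin t) + 2 * sin w * (sin t)\<^sup>2"
      by (simp add: algebra_simps power2_eq_square)
    also have "2 * real n * cos w * sin t = sin w * cos t" using eq by (simp add: w_def)
    also have "2 * cos t * (sin w * cos t) + 2 * sin w * (sin t)\<^sup>2 = 2 * sin w * ((sin t)\<^sup>2 + (cos t)\<^sup>2)"
      by algebra
    also have "\<dots> = sin t * (2 * u)" by (simp add: u[symmetric])
    finally show ?thesis using assms(2) by (simp del: mult_eq_0_iff)
  qed
  finally show "SU n (cos t) = smult u [: 2 / (4 * (real n)\<^sup>2 - 1) - (cos t)\<^sup>2, 1:]"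
    unfolding SU_def cheb_T_cos e u_def[symmetric] by (simp add: algebra_simps)
qed

section \<open>Integer multiples of rational polynomials\<close>

lemma coeff_pcompose_Rats:
  fixes p q :: "real poly"
  assumes "\<And>i. coeff p i \<in> \<rat>" "\<And>i. coeff q i \<in> \<rat>"
  shows "coeff (pcompose p q) i \<in> \<rat>"
  using assms(1)
proof (induction p arbitrary: i)
  case (pCons a p)
  have p: "coeff p i \<in> \<rat>" for i using pCons.prems[of "Suc i"] by simp
  have "a \<in> \<rat>" using pCons.prems[of 0] by simp
  moreover have "coeff (q * pcompose p q) i \<in> \<rat>"
    unfolding coeff_mult using pCons.IH[OF p] assms(2) by (intro Rats_sum Rats_mult)
  ultimately show ?case by (simp add: pcompose_pCons coeff_pCons split: nat.splits)
qed simp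

lemma common_denominator:
  fixes p :: "real poly"
  assumes "\<And>i. coeff p i \<in> \<rat>"
  shows "\<exists>d::int. d > 0 \<and> (\<forall>i. of_int d * coeff p i \<in> \<int>)"
  using assms
proof (induction p)
  case 0
  show ?case by (intro exI[of _ 1]) auto
next
  case (pCons a p)
  have "coeff p i \<in> \<rat>" for i using pCons.prems[of "Suc i"] by simp
  then obtain d where d: "d > 0" "\<And>i. of_int d * coeff p i \<in> \<int>" using pCons.IH by blast
  have "a \<in> \<rat>" using pCons.prems[of 0] by simp
  then obtain k m :: int where a: "m > 0" "a = of_int k / of_int m" by (rule Rats_cases')
  have "real_of_int (m * d) * a = of_int (d * k)" using a by simp
  then have "real_of_int (m * d) * a \<in> \<int>" by (metis Ints_of_int)
  moreover have "real_of_int (m * d) * coeff p i \<in> \<int>" for i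
    using d(2)[of i] by (simp add: mult.assoc)
  ultimately show ?case using a d
    by (intro exI[of _ "m * d"]) (auto simp: coeff_pCons split: nat.splits)
qed

text \<open>Clear denominators, then divide by the content. This provides a witness for the choice
  in \<open>jeff\<close>.\<close>

lemma primitive_int_multiple:
  fixes p :: "real poly"
  assumes "p \<noteq> 0" "\<And>i. coeff p i \<in> \<rat>"
  obtains J :: "int poly" and c :: real
  where "content J = 1" "c \<noteq> 0" "map_poly real_of_int J = smult c p"
proof -
  obtain d :: int where d: "d > 0" "\<And>i. of_int d * coeff p i \<in> \<int>"
    using common_denominator[OF assms(2)] by blast
  then obtain K where K: "smult (of_int d) p = map_poly of_int K"
    by (metis intpolyE coeff_smult)
  have "K \<noteq> 0" using K assms(1) d by auto
  have "smult (real_of_int (content K)) (map_poly real_of_int (primitive_part K)) = smult (of_int d) p"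
    unfolding K by (subst (2) content_times_primitive_part[symmetric])
      (simp add: poly_eq_iff coeff_map_poly del: content_times_primitive_part)
  then have "smult (1 / of_int (content K)) (smult (real_of_int (content K)) (map_poly real_of_int (primitive_part K)))
      = smult (1 / of_int (content K)) (smult (of_int d) p)"
    by simp
  then show thesis using \<open>K \<noteq> 0\<close> d
    by (intro that[of "primitive_part K" "of_int d / of_int (content K)"]) auto
qed

section \<open>Roots of the Jeff polynomial\<close>

definition jeff_root :: "nat \<Rightarrow> real \<Rightarrow> real" where
  "jeff_root n z = z\<^sup>2 - 2 / (4 * (real n)\<^sup>2 - 1)"

text \<open>The polynomial \<open>P\<close> with \<open>P(z\<^sup>2) = U'\<^bsub>2n-1\<^esub>(z)\<close> has degree at most \<open>n - 1\<close>, so the \<open>n - 1\<close> critical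
  angles account for all its roots.\<close>
lemma zetas_crit_angles:
  assumes n: "1 \<le> n" and crits: "\<forall>k\<in>{1..<n}. crit_angle n k (\<alpha> k) (\<theta> k)"
  defines "P \<equiv> every_second 0 (pderiv (cheb_U (2 * n - 1)))"
  shows "zetas n = cos ` \<theta> ` {1..<n}"
    and "\<exists>c. c \<noteq> 0 \<and> P = smult c (\<Prod>z\<in>zetas n. [:- (z\<^sup>2), 1:])"
    and "strict_mono_on {1..<n} \<theta>"
proof -
  note crit = bspec[OF crits]
  let ?U = "pderiv (cheb_U (2 * n - 1))"
  have b: "0 < \<theta> k" "\<theta> k < pi/2" "real k * pi / (2 * real n) < \<theta> k" "\<theta> k < real (Suc k) * pi / (2 * real n)"
    if "k \<in> {1..<n}" for k
  proof -
    have "k < n" using that by simp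
    note kb = crit_angle_bounds[OF crit[OF that] this]
    show "0 < \<theta> k" "\<theta> k < pi/2" "real k * pi / (2 * real n) < \<theta> k" "\<theta> k < real (Suc k) * pi / (2 * real n)"
      by (fact kb)+
  qed
  show mono: "strict_mono_on {1..<n} \<theta>"
  proof (rule strict_mono_onI)
    fix j k assume jk: "j \<in> {1..<n}" "k \<in> {1..<n}" "j < k"
    have "real (Suc j) * pi / (2 * real n) \<le> real k * pi / (2 * real n)"
      using jk n by (intro divide_right_mono mult_right_mono) auto
    then show "\<theta> j < \<theta> k" using b(4)[OF jk(1)] b(3)[OF jk(2)] by linarith
  qed
  have inj: "inj_on (\<lambda>k. cos (\<theta> k)) {1..<n}"
  proof (rule inj_onI)
    fix j k assume jk: "j \<in> {1..<n}" "k \<in> {1..<n}" "cos (\<theta> j) = cos (\<theta> k)"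
    have "\<theta> j = \<theta> k" 
      by (rule cos_inj_pi) (use b(1,2)[OF jk(1)] b(1,2)[OF jk(2)] jk(3) in linarith)+
    then show "j = k" using strict_mono_on_imp_inj_on[OF mono] jk by (auto dest: inj_onD)
  qed
  have root: "poly ?U (cos (\<theta> k)) = 0" if "k \<in> {1..<n}" for k
  proof -
    have "sin (\<theta> k) ^ 3 * poly ?U (cos (\<theta> k)) = 0"
      unfolding cheb_U_pderiv_cos using crit_angle_eq[OF crit[OF that]] n by (simp add: mult_ac)
    moreover have "sin (\<theta> k) \<noteq> 0" using sin_gt_zero[of "\<theta> k"] b[OF that] by simp
    ultimately show ?thesis by simp
  qed
  have sub: "cos ` \<theta> ` {1..<n} \<subseteq> zetas n"
    using root b by (auto simp: zetas_def intro!: cos_gt_zero)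
  have PU: "poly ?U z = poly P (z\<^sup>2)" for z
  proof -
    have "coeff ?U i = 0" if "\<And>k. i \<noteq> 2 * k + 0" for i
      using that[of "i div 2"] n by (auto simp: coeff_pderiv intro!: coeff_cheb_U_parity)
    from poly_every_second[where p = ?U and s = 0, OF this] show ?thesis by (simp add: P_def)
  qed
  have degP: "degree P \<le> n - 1" unfolding P_def using degree_cheb_U[of "2*n-1"]
    by (intro degree_every_second) (auto simp: degree_pderiv)
  have P0: "P \<noteq> 0"
  proof
    assume "P = 0"
    then have "?U = 0" using PU by (simp add: poly_all_0_iff_0[symmetric])
    then have "sin t ^ 3 * poly ?U (cos t) = 0" for t by simp
    \<comment> \<open>At \<open>pi/2\<close> the cosine vanishes and only the term
      \<open>2n * cos (n * pi)\<close> survives.\<close>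
    from this[of "pi/2"] have "cos (real n * pi) = 0" using n
      unfolding cheb_U_pderiv_cos by simp
    then show False by simp
  qed
  have fin: "finite {x. poly P x = 0}" using P0 by (rule poly_roots_finite)
  have sqi: "inj_on (\<lambda>z. z\<^sup>2) (zetas n)" by (auto simp: inj_on_def zetas_def)
  have sq: "(\<lambda>z. z\<^sup>2) ` zetas n \<subseteq> {x. poly P x = 0}" by (auto simp: zetas_def PU[symmetric])
  have finz: "finite (zetas n)" using finite_subset[OF sq fin] finite_imageD[OF _ sqi] by blast
  \<comment> \<open>Positive roots have distinct squares, so the degree of \<open>P\<close> bounds
    their number; with the \<open>n - 1\<close> known roots all inequalities become
    equalities.\<close>
  have "card (zetas n) = card ((\<lambda>z. z\<^sup>2) ` zetas n)" using sqi by (simp add: card_image)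
  also have "\<dots> \<le> card {x. poly P x = 0}" using sq fin by (rule card_mono[rotated])
  also have "\<dots> \<le> degree P" using P0 by (rule card_poly_roots_bound)
  finally have cd: "card (zetas n) \<le> degree P" .
  have cardi: "card (cos ` \<theta> ` {1..<n}) = n - 1" unfolding image_image using inj by (simp add: card_image)
  show eq: "zetas n = cos ` \<theta> ` {1..<n}"
    using card_seteq[OF finz sub] cd degP cardi by simp
  define Q where "Q = (\<Prod>z\<in>zetas n. [:- (z\<^sup>2), 1:])"
  have "degree Q = n - 1" unfolding Q_def
    by (subst degree_prod_eq_sum_degree) (use cardi eq in auto)
  moreover have lc: "lead_coeff Q = 1" unfolding Q_def by (simp add: lead_coeff_prod)
  moreover have dP: "degree P = n - 1" using cd degP cardi eq by simp
  ultimately have "P = smult (lead_coeff P) Q"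
  proof (intro poly_eqI_degree_lead_coeff[where A = "(\<lambda>z. z\<^sup>2) ` zetas n" and n = "n - 1"])
    show "n - 1 \<le> card ((\<lambda>z. z\<^sup>2) ` zetas n)" using sqi cardi eq by (simp add: card_image)
    show "poly P x = poly (smult (lead_coeff P) Q) x" if "x \<in> (\<lambda>z. z\<^sup>2) ` zetas n" for x
    proof -
      have "poly P x = 0" using that sq by blast
      moreover have "poly Q x = 0" using that finz by (auto simp: Q_def poly_prod prod_zero_iff)
      ultimately show ?thesis by simp
    qed
  qed (auto simp: degree_smult_le)
  then show "\<exists>c. c \<noteq> 0 \<and> P = smult c (\<Prod>z\<in>zetas n. [:- (z\<^sup>2), 1:])"
    using P0 unfolding Q_def by (intro exI[of _ "lead_coeff P"]) auto
qed

text \<open>By \<open>SU_crit\<close>, \<open>jeff_real n\<close> is a scalar multiple of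
  \<open>Q\<close>, the product of the factors \<open>x + \<epsilon> - z\<^sup>2\<close>. Shifting
  the argument of the rational polynomial \<open>P\<close> of \<open>zetas_crit_angles\<close> by
  the rational \<epsilon> shows that \<open>Q\<close> has a primitive integer multiple, so
  \<open>jeff\<close> satisfies its defining property.\<close>

lemma jeff_roots:
  assumes n: "1 \<le> n" and crits: "\<forall>k\<in>{1..<n}. crit_angle n k (\<alpha> k) (\<theta> k)"
  shows "{x. poly (map_poly real_of_int (jeff n)) x = 0} = jeff_root n ` cos ` \<theta> ` {1..<n}"
proof -
  define \<epsilon> where "\<epsilon> = 2 / (4 * (real n)\<^sup>2 - 1)"
  note crit = bspec[OF crits]
  note z = zetas_crit_angles[OF assms]
  have finz: "finite (zetas n)" by (simp add: z(1))
  have SU: "\<exists>u. u \<noteq> 0 \<and> SU n z = smult u [: \<epsilon> - z\<^sup>2, 1:]" if z_in: "z \<in> zetas n" for z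
  proof -
    obtain k where k: "k \<in> {1..<n}" "z = cos (\<theta> k)" using z_in unfolding z(1) by blast
    note c = crit[OF k(1)]
    have "sin (\<theta> k) \<noteq> 0" using crit_angle_bounds[OF c] k sin_gt_zero[of "\<theta> k"] by auto
    moreover have "sin (2 * real n * \<theta> k) \<noteq> 0"
      using crit_angle_multiple(2)[OF c] c cos_gt_zero[of "\<alpha> k"] by (simp add: crit_angle_def)
    ultimately show ?thesis using SU_crit[OF n _ _ crit_angle_eq[OF c]] unfolding k \<epsilon>_def by blast
  qed
  then obtain u where u: "\<And>z. z \<in> zetas n \<Longrightarrow> u z \<noteq> 0"
    "\<And>z. z \<in> zetas n \<Longrightarrow> SU n z = smult (u z) [: \<epsilon> - z\<^sup>2, 1:]" by metis
  define Q where "Q = (\<Prod>z\<in>zetas n. [: \<epsilon> - z\<^sup>2, 1:])"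
  define U where "U = (\<Prod>z\<in>zetas n. u z)"
  have U0: "U \<noteq> 0" using u(1) finz by (simp add: U_def)
  have jr: "jeff_real n = smult U Q"
    unfolding jeff_real_def Q_def U_def prod_smult[symmetric] by (rule prod.cong) (auto simp: u)
  obtain c where c: "c \<noteq> 0"
    "every_second 0 (pderiv (cheb_U (2*n-1))) = smult c (\<Prod>z\<in>zetas n. [:- (z\<^sup>2), 1:])"
    using z(2) by auto
  define R where "R = pcompose (every_second 0 (pderiv (cheb_U (2*n-1)))) [:\<epsilon>, 1:]"
  have RQ: "R = smult c Q"
    unfolding R_def c Q_def by (simp add: pcompose_smult pcompose_prod pcompose_pCons)
  have Q0: "Q \<noteq> 0" using finz by (simp add: Q_def)
  have "coeff R i \<in> \<rat>" for i unfolding R_def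
  proof (rule coeff_pcompose_Rats)
    fix i
    show "coeff (every_second 0 (pderiv (cheb_U (2*n-1)))) i \<in> \<rat>"
      using coeff_cheb_U_Ints Ints_subset_Rats by (auto simp: coeff_every_second coeff_pderiv intro!: Rats_mult Rats_add)
    show "coeff [:\<epsilon>, 1:] i \<in> \<rat>"
      by (auto simp: \<epsilon>_def coeff_pCons split: nat.splits intro!: Rats_divide Rats_diff Rats_mult)
  qed
  moreover have "R \<noteq> 0" using c Q0 RQ by simp
  ultimately obtain J :: "int poly" and d :: real
    where J: "content J = 1" "d \<noteq> 0" "map_poly real_of_int J = smult d R"
    using primitive_int_multiple by blast
  have "map_poly real_of_int J = smult (d * c / U) (jeff_real n)" using U0 by (simp add: J jr RQ)
  moreover have "d * c / U \<noteq> 0" using J c U0 by simp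
  ultimately have "content J = 1 \<and> (\<exists>c::real. c \<noteq> 0 \<and> map_poly real_of_int J = smult c (jeff_real n))"
    using J(1) by blast
  then have "content (jeff n) = 1 \<and> (\<exists>c::real. c \<noteq> 0 \<and> map_poly real_of_int (jeff n) = smult c (jeff_real n))"
    unfolding jeff_def by (rule someI)
  then obtain e where e: "e \<noteq> 0" "map_poly real_of_int (jeff n) = smult e (jeff_real n)" by blast
  have "{x. poly (map_poly real_of_int (jeff n)) x = 0} = {x. poly Q x = 0}"
    unfolding e jr using e U0 by simp
  also have "{x. poly Q x = 0} = jeff_root n ` zetas n"
  proof -
    have "\<epsilon> - z\<^sup>2 + x = 0 \<longleftrightarrow> x = jeff_root n z" for x z by (auto simp: jeff_root_def \<epsilon>_def)
    then have "poly Q x = 0 \<longleftrightarrow> (\<exists>z\<in>zetas n. x = jeff_root n z)" for x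
      using finz by (simp add: Q_def poly_prod)
    then show ?thesis by blast
  qed
  finally show ?thesis by (simp add: z(1))
qed

theorem theorem4:
  shows "\<exists>N::nat. \<forall>n\<ge>N. \<forall>x0::real.
     (poly (map_poly real_of_int (jeff n)) x0 = 0 \<and>
      x0 \<noteq> Min {x. poly (map_poly real_of_int (jeff n)) x = 0}) \<longrightarrow>
     (\<exists>x. x0 - 3 / (10 * (real n)^2) \<le> x \<and> x < x0 + 1 / (2 * (real n)^2) \<and>
          poly (mutt n) x = 0)"
\<comment> \<open>The threshold 6 is that of \<open>crit_angle_gap\<close>.\<close>
proof (rule exI[of _ 6], intro allI impI, elim conjE)
  fix n :: nat and x0 :: real
  assume n6: "6 \<le> n"
  then have n: "1 \<le> n" by simp
  have "\<exists>\<alpha> \<theta>. crit_angle n k \<alpha> \<theta>" if "k \<in> {1..<n}" for k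
    using crit_angle_exists[of k n] that by (metis atLeastLessThan_iff)
  then obtain \<alpha> \<theta> where crits: "\<forall>k\<in>{1..<n}. crit_angle n k (\<alpha> k) (\<theta> k)" by metis
  note crit = bspec[OF crits]
  note jr = jeff_roots[OF n crits]
  assume root: "poly (map_poly real_of_int (jeff n)) x0 = 0"
    and nmin: "x0 \<noteq> Min {x. poly (map_poly real_of_int (jeff n)) x = 0}"
  have "x0 \<in> jeff_root n ` cos ` \<theta> ` {1..<n}" unfolding jr[symmetric] using root by simp
  then obtain k where k: "k \<in> {1..<n}" and x0: "x0 = jeff_root n (cos (\<theta> k))" by blast
  \<comment> \<open>The squared cosine decreases, so the largest angle gives the smallest root,
    which is excluded. Otherwise the partner index \<open>k'\<close> would be 0, outside the range
    of the angles.\<close>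
  have "k \<noteq> n - 1"
  proof
    assume kn: "k = n - 1"
    have "Min (jeff_root n ` cos ` \<theta> ` {1..<n}) = x0"
    proof (rule Min_eqI)
      fix y assume "y \<in> jeff_root n ` cos ` \<theta> ` {1..<n}"
      then obtain j where j: "j \<in> {1..<n}" "y = jeff_root n (cos (\<theta> j))" by auto
      have jb: "0 < \<theta> j" "\<theta> j < pi/2" using crit_angle_bounds[OF crit[OF j(1)]] j by auto
      have kb: "0 < \<theta> k" "\<theta> k < pi/2" using crit_angle_bounds[OF crit[OF k]] k by auto
      have "\<theta> j \<le> \<theta> k"
        using strict_mono_onD[OF zetas_crit_angles(3)[OF n crits], of j k] j k kn by (cases "j = k") force+
      then have "cos (\<theta> k) \<le> cos (\<theta> j)" using jb kb by (intro cos_monotone_0_pi_le) auto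
      moreover have "0 \<le> cos (\<theta> k)" using kb by (intro cos_ge_zero) auto
      ultimately show "x0 \<le> y" unfolding x0 j jeff_root_def by (simp add: power_mono)
    qed (use k x0 in auto)
    then show False using nmin jr by simp
  qed
  define k' where "k' = n - 1 - k"
  have k': "k + k' + 1 = n" "1 \<le> k'" "k' \<in> {1..<n}" using k \<open>k \<noteq> n - 1\<close> by (auto simp: k'_def)
  note gap = crit_angle_gap[OF crit[OF k] crit[OF k'(3)] k'(1) _ k'(2) n6]
  have "sin (\<theta> k') \<noteq> 0"
    using crit_angle_bounds[OF crit[OF k'(3)]] k' sin_gt_zero[of "\<theta> k'"] by auto
  then have "poly (mutt n) ((sin (\<theta> k'))\<^sup>2) = 0"
    by (intro mutt_root[OF n] crit_angle_eq[OF crit[OF k'(3)]])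
  moreover have "1 \<le> k" using k by simp
  ultimately show "\<exists>x. x0 - 3 / (10 * (real n)^2) \<le> x \<and> x < x0 + 1 / (2 * (real n)^2) \<and> poly (mutt n) x = 0"
    using gap unfolding x0 jeff_root_def by (intro exI[of _ "(sin (\<theta> k'))\<^sup>2"]) auto
qed

end
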